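(* Let $\mathbf p=(p_1,\dots,p_r)$ and $\mathbf q=(q_1,\dots,q_r)$ be probability distributions on $\mathcal X=\{c_1,\dots,c_r\}$ with $p_j>0$ and $q_j>0$ for all $j\in D$, and let $\alpha>0$, $\alpha\ne1$. Let $\widehat{\mathbf p}_n$ and $\widehat{\mathbf q}_m$ be the empirical distributions of i.i.d. samples $X_1,\dots,X_n$ from $\mathbf p$ and $Y_1,\dots,Y_m$ from $\mathbf q$. Put $A_{T,\alpha,1}^{(s)}=(A_{T,\alpha,1}+A_{T,\alpha,4})/2$ and $A_{T,\alpha,2}^{(s)}=(A_{T,\alpha,2}+A_{T,\alpha,3})/2$. Then: (a) (One sample) $$\limsup_{n\to+\infty}\frac{|\mathcal D_{T,\alpha}^{(s)}(\widehat{\mathbf p}_n,\mathbf q)-\mathcal D_{T,\alpha}^{(s)}(\mathbf p,\mathbf q)|}{a_n}\le A_{T,\alpha,1}^{(s)}\quad\text{a.s.},\qquad\limsup_{n\to+\infty}\frac{|\mathcal D_{T,\alpha}^{(s)}(\mathbf p,\widehat{\mathbf q}_n)-\mathcal D_{T,\alpha}^{(s)}(\mathbf p,\mathbf q)|}{b_n}\le A_{T,\alpha,2}^{(s)}\quad\text{a.s.}$$ (b) (Two samples) $$\limsup_{(n,m)\to(+\infty,+\infty)}\frac{|\mathcal D_{T,\alpha}^{(s)}(\widehat{\mathbf p}_n,\widehat{\mathbf q}_m)-\mathcal D_{T,\alpha}^{(s)}(\mathbf p,\mathbf q)|}{c_{n,m}}\le A_{T,\alpha,1}^{(s)}+A_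{T,\alpha,2}^{(s)}\quad\text{a.s.}$$
   Context: $\mathcal X=\{c_1,\dots,c_r\}$ with $r\ge 2$ is a finite set of distinct points and $D=\{1,\dots,r\}$. A probability distribution $\mathbf p$ on $\mathcal X$ is identified with the vector $(p_1,\dots,p_r)$, $p_j$ being the mass of $c_j$. $X_1,X_2,\dots$ are i.i.d. with $\mathbb P(X_i=c_j)=p_j$, and $Y_1,Y_2,\dots$ are i.i.d. with $\mathbb P(Y_i=c_j)=q_j$; the two sequences are independent of each other. Empirical probabilities: $\widehat p_n^{c_j}=\frac1n\sum_{i=1}^n 1_{\{X_i=c_j\}}$, $\widehat q_m^{c_j}=\frac1m\sum_{i=1}^m 1_{\{Y_i=c_j\}}$, $\widehat{\mathbf p}_n=(\widehat p_n^{c_j})_{j\in D}$, $\widehat{\mathbf q}_m=(\widehat q_m^{c_j})_{j\in D}$. $a_n=\sup_{j\in D}|\widehat p_n^{c_j}-p_j|$, $b_m=\sup_{j\in D}|\widehat q_m^{c_j}-q_j|$, $c_{n,m}=\max(a_n,b_m)$. Tsallis-$\alpha$ divergence: $\mathcal D_{T,\alpha}(\mathbf p,\mathbf q)=\frac1{\alpha-1}\Bigl(\sum_{j\in D}p_j^\alpha q_j^{1-\alpha}-1\Bigr)$; symmetrized form: $\mathcal D_{T,\alpha}^{(s)}(\mathbf p,\mathbf q)=\frac12\bigl(\mathcal D_{T,\alpha}(\mathbf p,\mathbf q)+\mathcal D_{T,\alpha}(\mathbf q,\mathbf p)\bigr)$. $$A_{T,\alpha,1}=\frac{\alpha}{|\alpha-1|}\sum_{j\in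 D}(p_j/q_j)^{\alpha-1},\quad A_{T,\alpha,2}=\sum_{j\in D}(p_j/q_j)^{\alpha},\quad A_{T,\alpha,3}=\frac{\alpha}{|\alpha-1|}\sum_{j\in D}(q_j/p_j)^{\alpha-1},\quad A_{T,\alpha,4}=\sum_{j\in D}(q_j/p_j)^{\alpha}.$$ Conventions: a ratio $0/0$ is read as $0$; if an empirical divergence is undefined because some empirical probability vanishes, it is given the value $0$; $\limsup_{(n,m)\to(+\infty,+\infty)}x_{n,m}=\lim_{N\to\infty}\sup_{n,m\ge N}x_{n,m}$. *)

theory Defs
  imports "HOL-Probability.Probability"
begin

text \<open>
  A probability distribution on a finite set of distinct points c 1, \<dots>, c r is represented by its
  vector of masses, a function on the naturals of which only the values at 1, \<dots>, r matter.
\<close>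

definition is_distribution :: "nat \<Rightarrow> (nat \<Rightarrow> real) \<Rightarrow> bool" where
  "is_distribution r p \<longleftrightarrow> (\<forall>j\<in>{1..r}. 0 \<le> p j) \<and> (\<Sum>j\<in>{1..r}. p j) = 1"

definition iid_sample ::
  "'a measure \<Rightarrow> nat \<Rightarrow> (nat \<Rightarrow> 'x) \<Rightarrow> (nat \<Rightarrow> real) \<Rightarrow> (nat \<Rightarrow> 'a \<Rightarrow> 'x) \<Rightarrow> bool" where
  "iid_sample M r c p X \<longleftrightarrow>
     prob_space.indep_vars M (\<lambda>_. count_space (c ` {1..r})) X {1..} \<and>
     (\<forall>i\<ge>1. \<forall>j\<in>{1..r}. measure M {\<omega> \<in> space M. X i \<omega> = c j} = p j)"

text \<open>Independence of two sequences, as random elements of the product space of sequences.\<close>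

definition indep_sequences ::
  "'a measure \<Rightarrow> 'x set \<Rightarrow> (nat \<Rightarrow> 'a \<Rightarrow> 'x) \<Rightarrow> (nat \<Rightarrow> 'a \<Rightarrow> 'x) \<Rightarrow> bool" where
  "indep_sequences M S X Y \<longleftrightarrow>
     prob_space.indep_var M
       (\<Pi>\<^sub>M i\<in>{1..}. count_space S) (\<lambda>\<omega>. \<lambda>i\<in>{1..}. X i \<omega>)
       (\<Pi>\<^sub>M i\<in>{1..}. count_space S) (\<lambda>\<omega>. \<lambda>i\<in>{1..}. Y i \<omega>)"

definition empirical :: "(nat \<Rightarrow> 'x) \<Rightarrow> (nat \<Rightarrow> 'a \<Rightarrow> 'x) \<Rightarrow> nat \<Rightarrow> 'a \<Rightarrow> nat \<Rightarrow> real" where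
  "empirical c X n \<omega> j = 1 / real n * (\<Sum>i\<in>{1..n}. indicator {\<omega>'. X i \<omega>' = c j} \<omega>)"

definition sup_dist :: "nat \<Rightarrow> (nat \<Rightarrow> real) \<Rightarrow> (nat \<Rightarrow> real) \<Rightarrow> real" where
  "sup_dist r u v = (SUP j\<in>{1..r}. \<bar>u j - v j\<bar>)"

text \<open>
  For positive \<open>\<alpha>\<close>, a term \<open>p j powr \<alpha> * q j powr (1 - \<alpha>)\<close> of the divergence is undefined exactly if
  \<open>\<alpha> > 1\<close>, \<open>q j = 0\<close> and \<open>p j \<noteq> 0\<close>; for \<open>p j = q j = 0\<close> and \<open>\<alpha> > 1\<close> it is the ratio 0/0, read as 0.
  As \<open>0 powr x = 0\<close> for every \<open>x\<close>, the library power has the intended value in all other cases.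
  An undefined divergence is given the value 0, and the symmetrized divergence is undefined as soon
  as one of its two summands is.
\<close>

definition tsallis_defined :: "nat \<Rightarrow> real \<Rightarrow> (nat \<Rightarrow> real) \<Rightarrow> (nat \<Rightarrow> real) \<Rightarrow> bool" where
  "tsallis_defined r \<alpha> p q \<longleftrightarrow> (\<alpha> > 1 \<longrightarrow> (\<forall>j\<in>{1..r}. q j = 0 \<longrightarrow> p j = 0))"

definition tsallis :: "nat \<Rightarrow> real \<Rightarrow> (nat \<Rightarrow> real) \<Rightarrow> (nat \<Rightarrow> real) \<Rightarrow> real" where
  "tsallis r \<alpha> p q =
     (if tsallis_defined r \<alpha> p q
      then 1 / (\<alpha> - 1) * ((\<Sum>j\<in>{1..r}. p j powr \<alpha> * q j powr (1 - \<alpha>)) - 1)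
      else 0)"

definition tsallis_sym :: "nat \<Rightarrow> real \<Rightarrow> (nat \<Rightarrow> real) \<Rightarrow> (nat \<Rightarrow> real) \<Rightarrow> real" where
  "tsallis_sym r \<alpha> p q =
     (if tsallis_defined r \<alpha> p q \<and> tsallis_defined r \<alpha> q p
      then 1 / 2 * (tsallis r \<alpha> p q + tsallis r \<alpha> q p)
      else 0)"

definition A_T1 :: "nat \<Rightarrow> real \<Rightarrow> (nat \<Rightarrow> real) \<Rightarrow> (nat \<Rightarrow> real) \<Rightarrow> real" where
  "A_T1 r \<alpha> p q = \<alpha> / \<bar>\<alpha> - 1\<bar> * (\<Sum>j\<in>{1..r}. (p j / q j) powr (\<alpha> - 1))"

definition A_T2 :: "nat \<Rightarrow> real \<Rightarrow> (nat \<Rightarrow> real) \<Rightarrow> (nat \<Rightarrow> real) \<Rightarrow> real" where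
  "A_T2 r \<alpha> p q = (\<Sum>j\<in>{1..r}. (p j / q j) powr \<alpha>)"

definition A_T3 :: "nat \<Rightarrow> real \<Rightarrow> (nat \<Rightarrow> real) \<Rightarrow> (nat \<Rightarrow> real) \<Rightarrow> real" where
  "A_T3 r \<alpha> p q = \<alpha> / \<bar>\<alpha> - 1\<bar> * (\<Sum>j\<in>{1..r}. (q j / p j) powr (\<alpha> - 1))"

definition A_T4 :: "nat \<Rightarrow> real \<Rightarrow> (nat \<Rightarrow> real) \<Rightarrow> (nat \<Rightarrow> real) \<Rightarrow> real" where
  "A_T4 r \<alpha> p q = (\<Sum>j\<in>{1..r}. (q j / p j) powr \<alpha>)"

definition A_T1_sym :: "nat \<Rightarrow> real \<Rightarrow> (nat \<Rightarrow> real) \<Rightarrow> (nat \<Rightarrow> real) \<Rightarrow> real" where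
  "A_T1_sym r \<alpha> p q = (A_T1 r \<alpha> p q + A_T4 r \<alpha> p q) / 2"

definition A_T2_sym :: "nat \<Rightarrow> real \<Rightarrow> (nat \<Rightarrow> real) \<Rightarrow> (nat \<Rightarrow> real) \<Rightarrow> real" where
  "A_T2_sym r \<alpha> p q = (A_T2 r \<alpha> p q + A_T3 r \<alpha> p q) / 2"

definition limsup2 :: "(nat \<Rightarrow> nat \<Rightarrow> ereal) \<Rightarrow> ereal" where
  "limsup2 x = lim (\<lambda>N. SUP (n, m)\<in>{N..} \<times> {N..}. x n m)"

lemma limsup2_eq_Limsup:
  "limsup2 x = Limsup (sequentially \<times>\<^sub>F sequentially) (\<lambda>(n, m). x n m)"
proof -
  let ?S = "\<lambda>N. SUP (n, m)\<in>{N..} \<times> {N..}. x n m"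
  have "decseq ?S"
    by (intro antimonoI SUP_subset_mono) auto
  then have "?S \<longlonglongrightarrow> (INF N. ?S N)"
    by (rule LIMSEQ_INF)
  then have "limsup2 x = (INF N. ?S N)"
    unfolding limsup2_def by (rule limI)
  also have "\<dots> = Limsup (sequentially \<times>\<^sub>F sequentially) (\<lambda>(n, m). x n m)"
    unfolding Limsup_def
  proof (rule antisym)
    show "(INF N. ?S N) \<le>
        (INF P\<in>{P. eventually P (sequentially \<times>\<^sub>F sequentially)}. SUP z\<in>Collect P. case z of (n, m) \<Rightarrow> x n m)"
    proof (rule INF_greatest)
      fix P :: "nat \<times> nat \<Rightarrow> bool"
      assume "P \<in> {P. eventually P (sequentially \<times>\<^sub>F sequentially)}"
      then obtain N where "\<And>n m. n \<ge> N \<Longrightarrow> m \<ge> N \<Longrightarrow> P (n, m)"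
        by (auto simp: eventually_prod_sequentially)
      then have "?S N \<le> (SUP z\<in>Collect P. case z of (n, m) \<Rightarrow> x n m)"
        by (intro SUP_subset_mono) auto
      then show "(INF N. ?S N) \<le> (SUP z\<in>Collect P. case z of (n, m) \<Rightarrow> x n m)"
        by (rule INF_lower2[OF UNIV_I])
    qed
    show "(INF P\<in>{P. eventually P (sequentially \<times>\<^sub>F sequentially)}. SUP z\<in>Collect P. case z of (n, m) \<Rightarrow> x n m)
        \<le> (INF N. ?S N)"
    proof (rule INF_greatest)
      fix N :: nat
      have "eventually (\<lambda>z. z \<in> {N..} \<times> {N..}) (sequentially \<times>\<^sub>F sequentially)"
        by (auto simp: eventually_prod_sequentially)
      then show "(INF P\<in>{P. eventually P (sequentially \<times>\<^sub>F sequentially)}. SUP z\<in>Collect P. case z of (n, m) \<Rightarrow> x n m)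
          \<le> ?S N"
        by (intro INF_lower2[where i = "\<lambda>z. z \<in> {N..} \<times> {N..}"]) auto
    qed
  qed
  finally show ?thesis .
qed

end

theory Submission
  imports Defs
begin

text \<open>
  The symmetrized divergence is a sum of functions of the coordinate pairs that are differentiable at
  every pair of positive numbers, and the constants \<open>A\<^sub>1, A\<^sub>2\<close> bound the sums of the absolute values
  of their partial derivatives at \<open>(p, q)\<close>. Hence along any arguments \<open>u, v\<close> tending to \<open>p, q\<close> the
  deviation of the divergence is at most \<open>(A\<^sub>1 + e) |u - p| + (A\<^sub>2 + e) |v - q|\<close> eventually, where
  the norms are sup norms. The empirical distributions tend to the true ones almost surely, by
  Hoeffding's inequality and the Borel-Cantelli lemma.
\<close>

section \<open>First-order behaviour of one summand\<close>

text \<open>Both partial derivatives depend on \<open>x / y\<close> only. They are written as powers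
  of that ratio because these powers are the summands of \<open>A_T1\<close> and
  \<open>A_T2\<close>.\<close>

lemma powr_times_powr_has_derivative:
  fixes x y \<alpha> :: real
  assumes "x > 0" "y > 0"
  shows "((\<lambda>z. fst z powr \<alpha> * snd z powr (1 - \<alpha>)) has_derivative
           (\<lambda>h. \<alpha> * (x / y) powr (\<alpha> - 1) * fst h + (1 - \<alpha>) * (x / y) powr \<alpha> * snd h)) (at (x, y))"
proof -
  \<comment> \<open>Exponents shifted by one become quotients, so that the derivative from the
    product rule can be matched with the stated one by field arithmetic.\<close>
  have 1: "x powr (\<alpha> - 1) = x powr \<alpha> / x" "y powr (1 - \<alpha>) = y / y powr \<alpha>" "y powr (\<alpha> - 1) = y powr \<alpha> / y"
    using assms by (simp_all add: powr_diff)
  show ?thesis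
    by (rule derivative_eq_intros refl assms | use assms in \<open>simp add: 1 powr_divide field_simps fun_eq_iff\<close>)+
qed

text \<open>Differentiability bounds the remainder by \<open>e\<close> times the Euclidean norm of
  the increment, which is at most \<open>\<bar>u - x\<bar> + \<bar>v - y\<bar>\<close>; so the
  remainder is absorbed by adding \<open>e\<close> to each coefficient. The two increments stay
  separate because the one-sample bounds need one coefficient each.\<close>

lemma powr_times_powr_deviation:
  fixes x y \<alpha> e :: real
  assumes "x > 0" "y > 0" "\<alpha> > 0" "e > 0"
  shows "eventually (\<lambda>(u, v). \<bar>u powr \<alpha> * v powr (1 - \<alpha>) - x powr \<alpha> * y powr (1 - \<alpha>)\<bar>
            \<le> (\<alpha> * (x / y) powr (\<alpha> - 1) + e) * \<bar>u - x\<bar>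
              + (\<bar>\<alpha> - 1\<bar> * (x / y) powr \<alpha> + e) * \<bar>v - y\<bar>) (nhds (x, y))"
proof -
  let ?g = "\<lambda>z. fst z powr \<alpha> * snd z powr (1 - \<alpha>)"
  let ?D = "\<lambda>h. \<alpha> * (x / y) powr (\<alpha> - 1) * fst h + (1 - \<alpha>) * (x / y) powr \<alpha> * snd h"
  have "\<exists>d>0. \<forall>z\<in>UNIV. norm (z - (x, y)) < d \<longrightarrow>
      norm (?g z - ?g (x, y) - ?D (z - (x, y))) \<le> e * norm (z - (x, y))"
    using powr_times_powr_has_derivative[OF assms(1,2), of \<alpha>] \<open>e > 0\<close>
    unfolding has_derivative_within_alt by blast
  then obtain d where "d > 0" and d: "\<And>z. norm (z - (x, y)) < d \<Longrightarrow>
      norm (?g z - ?g (x, y) - ?D (z - (x, y))) \<le> e * norm (z - (x, y))"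
    by blast
  have "\<bar>u powr \<alpha> * v powr (1 - \<alpha>) - x powr \<alpha> * y powr (1 - \<alpha>)\<bar>
            \<le> (\<alpha> * (x / y) powr (\<alpha> - 1) + e) * \<bar>u - x\<bar>
              + (\<bar>\<alpha> - 1\<bar> * (x / y) powr \<alpha> + e) * \<bar>v - y\<bar>"
    if "dist (u, v) (x, y) < d" for u v
  proof -
    let ?s = "\<alpha> * (x / y) powr (\<alpha> - 1) * (u - x)" and ?t = "(1 - \<alpha>) * (x / y) powr \<alpha> * (v - y)"
    have "norm ((u, v) - (x, y)) \<le> \<bar>u - x\<bar> + \<bar>v - y\<bar>"
      by (simp add: norm_Pair sqrt_sum_squares_le_sum_abs)
    then have "e * norm ((u, v) - (x, y)) \<le> e * (\<bar>u - x\<bar> + \<bar>v - y\<bar>)"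
      using \<open>e > 0\<close> by (intro mult_left_mono) auto
    moreover have "\<bar>u powr \<alpha> * v powr (1 - \<alpha>) - x powr \<alpha> * y powr (1 - \<alpha>) - (?s + ?t)\<bar>
        \<le> e * norm ((u, v) - (x, y))"
      using d[of "(u, v)"] that by (simp add: dist_norm)
    moreover have "\<bar>?s\<bar> = \<alpha> * (x / y) powr (\<alpha> - 1) * \<bar>u - x\<bar>"
      "\<bar>?t\<bar> = \<bar>\<alpha> - 1\<bar> * (x / y) powr \<alpha> * \<bar>v - y\<bar>"
      using \<open>\<alpha> > 0\<close> by (simp_all add: abs_mult abs_minus_commute)
    ultimately have "\<bar>u powr \<alpha> * v powr (1 - \<alpha>) - x powr \<alpha> * y powr (1 - \<alpha>)\<bar>
        \<le> \<alpha> * (x / y) powr (\<alpha> - 1) * \<bar>u - x\<bar> + \<bar>\<alpha> - 1\<bar> * (x / y) powr \<alpha> * \<bar>v - y\<bar>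
          + e * (\<bar>u - x\<bar> + \<bar>v - y\<bar>)"
      by linarith
    then show ?thesis
      by (simp add: distrib_left distrib_right)
  qed
  then show ?thesis
    using \<open>d > 0\<close> by (auto simp: eventually_nhds_metric)
qed

section \<open>Deviation of the divergences in terms of sup distances\<close>

lemma abs_diff_le_sup_dist:
  assumes "j \<in> {1..r}"
  shows "\<bar>u j - v j\<bar> \<le> sup_dist r u v"
  unfolding sup_dist_def by (rule cSUP_upper[OF assms]) simp

lemma sup_dist_nonneg:
  assumes "r \<ge> 1"
  shows "sup_dist r u v \<ge> 0"
  using abs_diff_le_sup_dist[of 1 r u v] assms by (simp add: order_trans[OF abs_ge_zero])

lemma sup_dist_self:
  assumes "r \<ge> 1"
  shows "sup_dist r u u = 0"
  using assms by (simp add: sup_dist_def)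

text \<open>The bounds for the single summands are added over the finitely many \<open>j\<close>.
  The filter \<open>F\<close> is arbitrary so that both a sequence in \<open>n\<close> and a double
  sequence in \<open>(n, m)\<close> are covered.\<close>

lemma tsallis_deviation:
  fixes u v :: "'i \<Rightarrow> nat \<Rightarrow> real"
  assumes "r \<ge> 1" and pos: "\<forall>j\<in>{1..r}. p j > 0" "\<forall>j\<in>{1..r}. q j > 0"
    and \<alpha>: "\<alpha> > 0" "\<alpha> \<noteq> 1" and "e > 0"
    and u: "\<forall>j\<in>{1..r}. ((\<lambda>z. u z j) \<longlongrightarrow> p j) F"
    and v: "\<forall>j\<in>{1..r}. ((\<lambda>z. v z j) \<longlongrightarrow> q j) F"
  shows "eventually (\<lambda>z. tsallis_defined r \<alpha> (u z) (v z) \<and>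
           \<bar>tsallis r \<alpha> (u z) (v z) - tsallis r \<alpha> p q\<bar>
           \<le> (A_T1 r \<alpha> p q + e) * sup_dist r (u z) p + (A_T2 r \<alpha> p q + e) * sup_dist r (v z) q) F"
proof -
  let ?g = "\<lambda>p q j. p j powr \<alpha> * q j powr (1 - \<alpha>)"
  \<comment> \<open>After summation over \<open>r\<close> indices and division by
    \<open>\<bar>\<alpha> - 1\<bar>\<close>, the error \<open>\<delta>\<close> contributes
    \<open>e * r / (r + 1)\<close>, which is at most \<open>e\<close>.\<close>
  define \<delta> where "\<delta> = e * \<bar>\<alpha> - 1\<bar> / (real r + 1)"
  have \<delta>: "\<delta> > 0" "1 / \<bar>\<alpha> - 1\<bar> * (real r * \<delta>) \<le> e"
    using \<open>e > 0\<close> \<alpha> by (auto simp: \<delta>_def field_simps)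
  let ?a = "\<lambda>j. \<alpha> * (p j / q j) powr (\<alpha> - 1) + \<delta>" and ?b = "\<lambda>j. \<bar>\<alpha> - 1\<bar> * (p j / q j) powr \<alpha> + \<delta>"
  have "eventually (\<lambda>z. \<forall>j\<in>{1..r}. v z j > 0 \<and> \<bar>?g (u z) (v z) j - ?g p q j\<bar>
      \<le> ?a j * \<bar>u z j - p j\<bar> + ?b j * \<bar>v z j - q j\<bar>) F"
  proof (intro eventually_ball_finite ballI eventually_conj)
    fix j assume j: "j \<in> {1..r}"
    have "((\<lambda>z. (u z j, v z j)) \<longlongrightarrow> (p j, q j)) F"
      using u v j by (intro tendsto_Pair) auto
    from eventually_compose_filterlim[OF powr_times_powr_deviation this, of \<alpha> \<delta>] pos j \<alpha> \<delta>
    show "eventually (\<lambda>z. \<bar>?g (u z) (v z) j - ?g p q j\<bar>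
      \<le> ?a j * \<bar>u z j - p j\<bar> + ?b j * \<bar>v z j - q j\<bar>) F"
      by simp
    \<comment> \<open>The limit \<open>q j\<close> is positive. This keeps the divergence defined
      eventually, so that its default value 0 does not occur.\<close>
    show "eventually (\<lambda>z. v z j > 0) F"
      using order_tendstoD(1) v pos j by blast
  qed auto
  then show ?thesis
  proof (rule eventually_mono, intro conjI)
    fix z assume z: "\<forall>j\<in>{1..r}. v z j > 0 \<and> \<bar>?g (u z) (v z) j - ?g p q j\<bar>
      \<le> ?a j * \<bar>u z j - p j\<bar> + ?b j * \<bar>v z j - q j\<bar>"
    let ?A = "sup_dist r (u z) p" and ?B = "sup_dist r (v z) q"
    show def: "tsallis_defined r \<alpha> (u z) (v z)"
      using z by (force simp: tsallis_defined_def)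
    have def': "tsallis_defined r \<alpha> p q"
      using pos by (force simp: tsallis_defined_def)
    show "\<bar>tsallis r \<alpha> (u z) (v z) - tsallis r \<alpha> p q\<bar>
           \<le> (A_T1 r \<alpha> p q + e) * ?A + (A_T2 r \<alpha> p q + e) * ?B"
    proof -
      have "tsallis r \<alpha> (u z) (v z) - tsallis r \<alpha> p q
          = 1 / (\<alpha> - 1) * (\<Sum>j\<in>{1..r}. ?g (u z) (v z) j - ?g p q j)"
        using def def' by (simp add: tsallis_def sum_subtractf diff_divide_distrib)
      then have "\<bar>tsallis r \<alpha> (u z) (v z) - tsallis r \<alpha> p q\<bar>
          = 1 / \<bar>\<alpha> - 1\<bar> * \<bar>\<Sum>j\<in>{1..r}. ?g (u z) (v z) j - ?g p q j\<bar>"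
        by (simp add: abs_mult)
      also have "\<dots> \<le> 1 / \<bar>\<alpha> - 1\<bar> * (\<Sum>j\<in>{1..r}. ?a j * ?A + ?b j * ?B)"
      proof (intro mult_left_mono order_trans[OF sum_abs] sum_mono)
        fix j assume j: "j \<in> {1..r}"
        have "?a j * \<bar>u z j - p j\<bar> + ?b j * \<bar>v z j - q j\<bar> \<le> ?a j * ?A + ?b j * ?B"
          using \<alpha> \<delta> j by (intro add_mono mult_left_mono abs_diff_le_sup_dist) auto
        with z j show "\<bar>?g (u z) (v z) j - ?g p q j\<bar> \<le> ?a j * ?A + ?b j * ?B"
          by fastforce
      qed auto
      also have "(\<Sum>j\<in>{1..r}. ?a j * ?A + ?b j * ?B)
          = (\<alpha> * (\<Sum>j\<in>{1..r}. (p j / q j) powr (\<alpha> - 1)) + real r * \<delta>) * ?A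
            + (\<bar>\<alpha> - 1\<bar> * A_T2 r \<alpha> p q + real r * \<delta>) * ?B"
        by (simp add: A_T2_def sum.distrib flip: sum_distrib_left sum_distrib_right)
      \<comment> \<open>The factor \<open>1 / \<bar>\<alpha> - 1\<bar>\<close> completes the
        prefactor of \<open>A_T1\<close> and cancels against \<open>\<bar>\<alpha> - 1\<bar>\<close>
        in front of \<open>A_T2\<close>.\<close>
      also have "1 / \<bar>\<alpha> - 1\<bar> * \<dots> = (A_T1 r \<alpha> p q + 1 / \<bar>\<alpha> - 1\<bar> * (real r * \<delta>)) * ?A
          + (A_T2 r \<alpha> p q + 1 / \<bar>\<alpha> - 1\<bar> * (real r * \<delta>)) * ?B"
        using \<alpha> by (simp add: A_T1_def distrib_left distrib_right)
      also have "\<dots> \<le> (A_T1 r \<alpha> p q + e) * ?A + (A_T2 r \<alpha> p q + e) * ?B"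
        using \<delta> \<open>r \<ge> 1\<close> by (intro add_mono mult_right_mono sup_dist_nonneg) auto
      finally show ?thesis .
    qed
  qed
qed

text \<open>This is the average of the bounds for \<open>(p, q)\<close> and \<open>(q, p)\<close>.
  Swapping the arguments turns \<open>A_T1\<close> into \<open>A_T3\<close> and \<open>A_T2\<close>
  into \<open>A_T4\<close>, so the distance of \<open>u\<close> collects \<open>A_T1\<close> and
  \<open>A_T4\<close>, that of \<open>v\<close> collects \<open>A_T2\<close> and
  \<open>A_T3\<close>.\<close>

lemma tsallis_sym_deviation:
  fixes u v :: "'i \<Rightarrow> nat \<Rightarrow> real"
  assumes "r \<ge> 1" and pos: "\<forall>j\<in>{1..r}. p j > 0" "\<forall>j\<in>{1..r}. q j > 0"
    and \<alpha>: "\<alpha> > 0" "\<alpha> \<noteq> 1" and e: "e > 0"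
    and u: "\<forall>j\<in>{1..r}. ((\<lambda>z. u z j) \<longlongrightarrow> p j) F"
    and v: "\<forall>j\<in>{1..r}. ((\<lambda>z. v z j) \<longlongrightarrow> q j) F"
  shows "eventually (\<lambda>z. \<bar>tsallis_sym r \<alpha> (u z) (v z) - tsallis_sym r \<alpha> p q\<bar>
           \<le> (A_T1_sym r \<alpha> p q + e) * sup_dist r (u z) p
             + (A_T2_sym r \<alpha> p q + e) * sup_dist r (v z) q) F"
  using tsallis_deviation[OF \<open>r \<ge> 1\<close> pos \<alpha> e u v]
    tsallis_deviation[OF \<open>r \<ge> 1\<close> pos(2,1) \<alpha> e v u]
proof eventually_elim
  case (elim z)
  have "A_T1 r \<alpha> q p = A_T3 r \<alpha> p q" "A_T2 r \<alpha> q p = A_T4 r \<alpha> p q"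
    by (simp_all add: A_T1_def A_T2_def A_T3_def A_T4_def)
  moreover have "tsallis_defined r \<alpha> p q" "tsallis_defined r \<alpha> q p"
    using pos by (force simp: tsallis_defined_def)+
  ultimately show ?case
    using elim by (simp add: tsallis_sym_def A_T1_sym_def A_T2_sym_def algebra_simps add_divide_distrib) argo
qed

lemma A_T_sym_nonneg:
  assumes "\<alpha> > 0"
  shows "A_T1_sym r \<alpha> p q \<ge> 0" "A_T2_sym r \<alpha> p q \<ge> 0"
  using assms
  by (auto simp: A_T1_sym_def A_T2_sym_def A_T1_def A_T2_def A_T3_def A_T4_def
      intro!: add_nonneg_nonneg divide_nonneg_nonneg mult_nonneg_nonneg sum_nonneg)

section \<open>From deviation bounds to limits superior\<close>

lemma Limsup_ratio_le:
  fixes f g :: "'i \<Rightarrow> real"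
  assumes g: "\<And>z. g z \<ge> 0" and "C \<ge> 0"
    and bound: "\<And>e. e > 0 \<Longrightarrow> eventually (\<lambda>z. f z \<le> (C + e) * g z) F"
  shows "Limsup F (\<lambda>z. ereal (f z / g z)) \<le> ereal C"
proof (rule ereal_le_epsilon2)
  fix e :: real assume "e > 0"
  from bound[OF this] have "eventually (\<lambda>z. ereal (f z / g z) \<le> ereal C + ereal e) F"
  proof eventually_elim
    case (elim z)
    \<comment> \<open>For \<open>g z = 0\<close> the quotient is 0, in accordance with the
      convention for 0/0, and \<open>C + e\<close> is nonnegative.\<close>
    with g[of z] \<open>C \<ge> 0\<close> \<open>e > 0\<close> show ?case
      by (cases "g z = 0") (auto simp: divide_le_eq)
  qed
  then show "Limsup F (\<lambda>z. ereal (f z / g z)) \<le> ereal C + ereal e"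
    by (rule Limsup_bounded)
qed

section \<open>Almost sure convergence of the empirical distributions\<close>

text \<open>For a fixed deviation \<open>e\<close> the Hoeffding bound is geometric in
  \<open>n\<close>, hence summable, so almost surely only finitely many averages deviate by
  \<open>e\<close> or more.\<close>

lemma (in prob_space) strong_law_bounded:
  fixes Z :: "nat \<Rightarrow> 'a \<Rightarrow> real"
  assumes indep: "indep_vars (\<lambda>_. borel) Z {1..}"
    and bnd: "\<And>i. i \<ge> 1 \<Longrightarrow> AE \<omega> in M. Z i \<omega> \<in> {a..b}" and "a < b"
    and mean: "\<And>i. i \<ge> 1 \<Longrightarrow> expectation (Z i) = \<mu>"
  shows "AE \<omega> in M. (\<lambda>n. (\<Sum>i\<in>{1..n}. Z i \<omega>) / real n) \<longlonglongrightarrow> \<mu>"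
proof -
  have [measurable]: "Z i \<in> borel_measurable M" if "i \<in> {1..n}" for i n
    using indep that by (auto simp: indep_vars_def)
  have dev: "AE \<omega> in M. eventually (\<lambda>n. \<bar>(\<Sum>i\<in>{1..n}. Z i \<omega>) / real n - \<mu>\<bar> < e) sequentially"
    if "e > 0" for e
  proof -
    define A where "A n = {\<omega> \<in> space M. \<bar>(\<Sum>i\<in>{1..n}. Z i \<omega>) - real n * \<mu>\<bar> \<ge> e * real n}" for n
    have [measurable]: "A n \<in> events" for n
      unfolding A_def by measurable
    \<comment> \<open>With \<open>n\<close> ranges of length \<open>b - a\<close> and deviation
      \<open>e * n\<close> of the sum, the exponent in Hoeffding's bound is linear in
      \<open>n\<close>, and the bound is \<open>2 * x ^ n\<close>.\<close>
    define x where "x = exp (- 2 * e\<^sup>2 / (b - a)\<^sup>2)"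
    have x: "0 \<le> x" "x < 1"
      using \<open>e > 0\<close> \<open>a < b\<close> by (auto simp: x_def)
    have le: "prob (A n) \<le> 2 * x ^ n" if "n \<ge> 1" for n
    proof -
      interpret Hoeffding_ineq M "{1..n}" Z "\<lambda>_. a" "\<lambda>_. b" "real n * \<mu>"
      proof unfold_locales
        show "indep_vars (\<lambda>_. borel) Z {1..n}"
          by (rule indep_vars_subset[OF indep]) auto
      qed (use bnd mean in auto)
      have "prob (A n) \<le> 2 * exp (- 2 * (e * real n)\<^sup>2 / (\<Sum>i\<in>{1..n}. (b - a)\<^sup>2))"
        unfolding A_def using \<open>e > 0\<close> \<open>a < b\<close> that by (intro Hoeffding_ineq_abs_ge) auto
      also have "- 2 * (e * real n)\<^sup>2 / (\<Sum>i\<in>{1..n}. (b - a)\<^sup>2) = real n * (- 2 * e\<^sup>2 / (b - a)\<^sup>2)"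
        using that by (simp add: power2_eq_square)
      also have "exp \<dots> = x ^ n"
        unfolding x_def by (rule exp_of_nat_mult)
      finally show ?thesis .
    qed
    have "summable (\<lambda>n. prob (A n))"
    proof (rule summable_comparison_test')
      show "summable (\<lambda>n. 2 * x ^ n)"
        using x by (intro summable_mult summable_geometric) auto
      show "norm (prob (A n)) \<le> 2 * x ^ n" if "n \<ge> 1" for n
        using le[OF that] by simp
    qed
    then have "AE \<omega> in M. eventually (\<lambda>n. \<omega> \<in> space M - A n) sequentially"
      by (intro borel_cantelli_AE1) (auto simp: less_top[symmetric])
    then show ?thesis
    proof eventually_elim
      case (elim \<omega>)
      then show ?case
        using eventually_gt_at_top[of 0]
      proof eventually_elim
        case (elim n)
        then have "\<bar>(\<Sum>i\<in>{1..n}. Z i \<omega>) - real n * \<mu>\<bar> < e * real n"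
          by (auto simp: A_def)
        moreover have "(\<Sum>i\<in>{1..n}. Z i \<omega>) / real n - \<mu> = ((\<Sum>i\<in>{1..n}. Z i \<omega>) - real n * \<mu>) / real n"
          using elim by (simp add: field_simps)
        ultimately show ?case
          using elim by (simp add: divide_less_eq)
      qed
    qed
  qed
  \<comment> \<open>Exceptional null sets may be united only countably often, so \<open>e\<close> is
    restricted to the values \<open>1 / (k + 1)\<close>.\<close>
  have "AE \<omega> in M. \<forall>k. eventually (\<lambda>n. \<bar>(\<Sum>i\<in>{1..n}. Z i \<omega>) / real n - \<mu>\<bar> < inverse (real (Suc k))) sequentially"
    by (intro AE_all_countable[THEN iffD2] allI dev) simp
  then show ?thesis
  proof eventually_elim
    case (elim \<omega>)
    show ?case
    proof (rule tendstoI)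
      fix e :: real assume "e > 0"
      then obtain k where k: "inverse (real (Suc k)) < e"
        using reals_Archimedean by blast
      from elim[rule_format, of k]
      show "eventually (\<lambda>n. dist ((\<Sum>i\<in>{1..n}. Z i \<omega>) / real n) \<mu> < e) sequentially"
        by eventually_elim (use k in \<open>simp add: dist_real_def\<close>)
    qed
  qed
qed

text \<open>The indicators of \<open>X i = c j\<close> are independent, lie in \<open>[0, 1]\<close>
  and have mean \<open>p j\<close>, so the law for bounded variables applies to each
  \<open>j\<close>; the finitely many null sets are then united.\<close>

lemma empirical_tendsto:
  assumes "prob_space M" and iid: "iid_sample M r c p X"
  shows "AE \<omega> in M. \<forall>j\<in>{1..r}. (\<lambda>n. empirical c X n \<omega> j) \<longlonglongrightarrow> p j"
proof -
  interpret prob_space M by fact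
  have indep: "indep_vars (\<lambda>_. count_space (c ` {1..r})) X {1..}"
    and mass: "\<And>i j. i \<ge> 1 \<Longrightarrow> j \<in> {1..r} \<Longrightarrow> prob {\<omega> \<in> space M. X i \<omega> = c j} = p j"
    using iid by (auto simp: iid_sample_def)
  have rv: "X i \<in> measurable M (count_space (c ` {1..r}))" if "i \<ge> 1" for i
    using indep that by (auto simp: indep_vars_def)
  have "AE \<omega> in M. (\<lambda>n. empirical c X n \<omega> j) \<longlonglongrightarrow> p j" if j: "j \<in> {1..r}" for j
  proof -
    let ?Z = "\<lambda>i \<omega>. indicator {c j} (X i \<omega>) :: real"
    have "AE \<omega> in M. (\<lambda>n. (\<Sum>i\<in>{1..n}. ?Z i \<omega>) / real n) \<longlonglongrightarrow> p j"
    proof (rule strong_law_bounded)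
      show "indep_vars (\<lambda>_. borel) ?Z {1..}"
        by (rule indep_vars_compose2[OF indep]) simp
      show "AE \<omega> in M. ?Z i \<omega> \<in> {0..1}" for i
        by (auto simp: indicator_def)
      show "expectation (?Z i) = p j" if "i \<ge> 1" for i
      proof -
        have "{\<omega> \<in> space M. X i \<omega> = c j} = X i -` {c j} \<inter> space M"
          by auto
        also have "\<dots> \<in> events"
          using j by (intro measurable_sets[OF rv[OF that]]) auto
        finally have ev: "{\<omega> \<in> space M. X i \<omega> = c j} \<in> events" .
        have "expectation (?Z i) = expectation (indicator {\<omega> \<in> space M. X i \<omega> = c j})"
          by (intro Bochner_Integration.integral_cong) (auto simp: indicator_def)
        also have "\<dots> = p j"
          using ev mass[OF that j] by simp
        finally show ?thesis .
      qed
    qed simp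
    then show ?thesis
      by (simp add: empirical_def indicator_def)
  qed
  then show ?thesis
    by (intro AE_ball_countable[THEN iffD2]) auto
qed

theorem corollary3:
  fixes M :: "'a measure"
    and r :: nat
    and c :: "nat \<Rightarrow> 'x"
    and p q :: "nat \<Rightarrow> real"
    and X Y :: "nat \<Rightarrow> 'a \<Rightarrow> 'x"
    and \<alpha> :: real
  assumes "prob_space M"
    and "r \<ge> 2"
    and "inj_on c {1..r}"
    and "is_distribution r p" and "is_distribution r q"
    and "\<forall>j\<in>{1..r}. p j > 0" and "\<forall>j\<in>{1..r}. q j > 0"
    and "\<alpha> > 0" and "\<alpha> \<noteq> 1"
    and "iid_sample M r c p X" and "iid_sample M r c q Y"
    and "indep_sequences M (c ` {1..r}) X Y"
  shows
    "(AE \<omega> in M.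
        limsup (\<lambda>n. ereal (\<bar>tsallis_sym r \<alpha> (empirical c X n \<omega>) q - tsallis_sym r \<alpha> p q\<bar>
                           / sup_dist r (empirical c X n \<omega>) p))
        \<le> ereal (A_T1_sym r \<alpha> p q)) \<and>
     (AE \<omega> in M.
        limsup (\<lambda>n. ereal (\<bar>tsallis_sym r \<alpha> p (empirical c Y n \<omega>) - tsallis_sym r \<alpha> p q\<bar>
                           / sup_dist r (empirical c Y n \<omega>) q))
        \<le> ereal (A_T2_sym r \<alpha> p q)) \<and>
     (AE \<omega> in M.
        limsup2 (\<lambda>n m. ereal (\<bar>tsallis_sym r \<alpha> (empirical c X n \<omega>) (empirical c Y m \<omega>)
                               - tsallis_sym r \<alpha> p q\<bar>
                             / max (sup_dist r (empirical c X n \<omega>) p) (sup_dist r (empirical c Y m \<omega>) q)))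
        \<le> ereal (A_T1_sym r \<alpha> p q + A_T2_sym r \<alpha> p q))"

\<comment> \<open>One-sample and two-sample bounds\<close>
proof -
  have r: "r \<ge> 1"
    using assms(2) by simp
  note dev = tsallis_sym_deviation[OF r assms(6-9)]
  note nonneg = A_T_sym_nonneg[OF assms(8)]
  have "AE \<omega> in M. \<forall>j\<in>{1..r}. (\<lambda>n. empirical c X n \<omega> j) \<longlonglongrightarrow> p j"
    by (rule empirical_tendsto[OF assms(1,10)])
  moreover have "AE \<omega> in M. \<forall>j\<in>{1..r}. (\<lambda>n. empirical c Y n \<omega> j) \<longlonglongrightarrow> q j"
    by (rule empirical_tendsto[OF assms(1,11)])
  \<comment> \<open>All three claims hold at each \<open>\<omega>\<close> where both empirical
    distributions converge; what remains is deterministic.\<close>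
  ultimately show ?thesis
    unfolding AE_conj_iff[symmetric]
  proof eventually_elim
    case (elim \<omega>)
    let ?P = "\<lambda>n. empirical c X n \<omega>" and ?Q = "\<lambda>n. empirical c Y n \<omega>"
    let ?A = "A_T1_sym r \<alpha> p q" and ?B = "A_T2_sym r \<alpha> p q"
    note X = elim(1) and Y = elim(2)
    \<comment> \<open>The known distribution enters as a constant sequence, whose sup distance to
      its limit is 0, so only one term of the bound is left.\<close>
    have "limsup (\<lambda>n. ereal (\<bar>tsallis_sym r \<alpha> (?P n) q - tsallis_sym r \<alpha> p q\<bar> / sup_dist r (?P n) p)) \<le> ereal ?A"
      using dev[OF _ X, of _ "\<lambda>_. q"]
      by (intro Limsup_ratio_le sup_dist_nonneg[OF r] nonneg) (auto simp: sup_dist_self[OF r])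
    moreover have "limsup (\<lambda>n. ereal (\<bar>tsallis_sym r \<alpha> p (?Q n) - tsallis_sym r \<alpha> p q\<bar> / sup_dist r (?Q n) q)) \<le> ereal ?B"
      using dev[OF _ _ Y, of _ "\<lambda>_. p"]
      by (intro Limsup_ratio_le sup_dist_nonneg[OF r] nonneg) (auto simp: sup_dist_self[OF r])
    moreover have "limsup2 (\<lambda>n m. ereal (\<bar>tsallis_sym r \<alpha> (?P n) (?Q m) - tsallis_sym r \<alpha> p q\<bar>
        / max (sup_dist r (?P n) p) (sup_dist r (?Q m) q))) \<le> ereal (?A + ?B)"
      unfolding limsup2_eq_Limsup case_prod_unfold
    proof (rule Limsup_ratio_le)
      fix e :: real assume "e > 0"
      have XY: "\<forall>j\<in>{1..r}. ((\<lambda>z. ?P (fst z) j) \<longlongrightarrow> p j) (sequentially \<times>\<^sub>F sequentially)"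
        "\<forall>j\<in>{1..r}. ((\<lambda>z. ?Q (snd z) j) \<longlongrightarrow> q j) (sequentially \<times>\<^sub>F sequentially)"
        using X Y by (auto intro: filterlim_compose[OF _ filterlim_fst] filterlim_compose[OF _ filterlim_snd])
      \<comment> \<open>Each of the two coefficients carries its own error term; the two halves add
        up to \<open>e\<close>.\<close>
      have "e / 2 > 0"
        using \<open>e > 0\<close> by simp
      from dev[OF this XY]
      show "eventually (\<lambda>z. \<bar>tsallis_sym r \<alpha> (?P (fst z)) (?Q (snd z)) - tsallis_sym r \<alpha> p q\<bar>
          \<le> (?A + ?B + e) * max (sup_dist r (?P (fst z)) p) (sup_dist r (?Q (snd z)) q))
        (sequentially \<times>\<^sub>F sequentially)"
      proof eventually_elim
        case (elim z)
        let ?a = "sup_dist r (?P (fst z)) p" and ?b = "sup_dist r (?Q (snd z)) q"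
        \<comment> \<open>Both distances are replaced by their maximum, which is allowed as the
          coefficients are nonnegative.\<close>
        have "(?A + e / 2) * ?a + (?B + e / 2) * ?b
            \<le> (?A + e / 2) * max ?a ?b + (?B + e / 2) * max ?a ?b"
          using nonneg \<open>e > 0\<close> by (intro add_mono mult_left_mono) auto
        with elim show ?case
          by (simp add: algebra_simps)
      qed
    qed (use nonneg in \<open>auto intro: max.coboundedI1 sup_dist_nonneg[OF r]\<close>)
    ultimately show ?case
      by blast
  qed
qed

end
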